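(* For every fixed integer $N\ge1$, $$\delta_p(2,N)\simeq\sqrt{\frac{N^N}{(\pi p)^{N-1}}}\qquad(p\to\infty),$$ where $x_p\simeq y_p$ means $x_p/y_p\to1$.
   Context: For integers $M,N,p\ge1$, $\delta_p(M,N)=\frac{1}{(MN)^p}\#\{(a,b)\in\mathbb Z_M^p\times\mathbb Z_N^p:\{(a_y,b_y)\}_{y=1}^p=\{(a_y,b_{y+1})\}_{y=1}^p\text{ as multisets}\}$, with $b_{p+1}=b_1$. *)

theory Defs
  imports Complex_Main "HOL-Library.FuncSet" "HOL-Library.Multiset" "HOL-Library.Landau_Symbols"
begin

text \<open>Indices y = 1..p are encoded as {0..<p}; the cyclic successor of y is (y+1) mod p.
  Z_M is encoded as {0..<M}. Tuples are extensional functions (PiE).\<close>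

definition cyc_pairs :: "nat \<Rightarrow> nat \<Rightarrow> nat \<Rightarrow> ((nat \<Rightarrow> nat) \<times> (nat \<Rightarrow> nat)) set" where
  "cyc_pairs M N p = {(a, b). a \<in> {0..<p} \<rightarrow>\<^sub>E {0..<M} \<and> b \<in> {0..<p} \<rightarrow>\<^sub>E {0..<N} \<and>
     image_mset (\<lambda>y. (a y, b y)) (mset_set {0..<p}) =
     image_mset (\<lambda>y. (a y, b ((y + 1) mod p))) (mset_set {0..<p})}"

definition delta :: "nat \<Rightarrow> nat \<Rightarrow> nat \<Rightarrow> real" where
  "delta M N p = real (card (cyc_pairs M N p)) / (real M * real N) ^ p"

end

theory Submission
  imports Defs "HOL-Probability.Probability" "HOL-Real_Asymp.Real_Asymp"
begin

text \<open>Identify a binary tuple a with the set X of positions where it is 1, and let Y be the cyclic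
  shift of X. The multiset condition says that b has the same content on X - Y and on Y - X.
  These sets have equal size k, and X is determined by the even set of its 2k boundary points together
  with one bit. So delta is the average of the probability that two random words of length k over
  N letters have equal content, where 2k is a binomial(p, 1/2) variable conditioned to be even, hence
  concentrated at p/2.

  Conditioning on the number of occurrences of one letter expresses this collision probability for
  N + 1 letters as a sum over squared binomial weights of the one for N letters. The squared weights
  have total mass asymptotic to a multiple of k to the power -1/2 and are concentrated too, so in both
  sums the averaged function may be replaced by its value at the concentration point.\<close>

section \<open>Averages over binomial weights\<close>

text \<open>Hoeffding's inequality for a binomial variable, written as a finite sum so that it can
  be compared term by term with other weights.\<close>

lemma binomial_tail_bound:
  fixes r \<epsilon> :: real
  assumes r: "0 \<le> r" "r \<le> 1" and eps: "0 \<le> \<epsilon>" and n: "n > 0"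
  shows "(\<Sum>j | j \<le> n \<and> \<epsilon> * n \<le> \<bar>real j - r * n\<bar>. real (n choose j) * r ^ j * (1 - r) ^ (n - j))
      \<le> 2 * exp (- 2 * \<epsilon>\<^sup>2 * n)"
proof -
  interpret binomial_distribution n r by unfold_locales (use r in auto)
  let ?S = "{j. j \<le> n \<and> \<epsilon> * n \<le> \<bar>real j - r * n\<bar>}"
  have "(\<Sum>j\<in>?S. real (n choose j) * r ^ j * (1 - r) ^ (n - j)) = (\<Sum>j\<in>?S. pmf (binomial_pmf n r) j)"
    using r by simp
  also have "\<dots> = measure (binomial_pmf n r) ?S"
    by (subst measure_measure_pmf_finite) auto
  also have "\<dots> \<le> measure (binomial_pmf n r) {x. \<bar>real x - real n * r\<bar> \<ge> \<epsilon> * n}"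
    by (rule measure_pmf.finite_measure_mono) (auto simp: mult.commute)
  also have "\<dots> \<le> 2 * exp (-2 * (\<epsilon> * n)\<^sup>2 / n)"
    by (rule prob_abs_ge) (use eps n in auto)
  also have "-2 * (\<epsilon> * n)\<^sup>2 / n = - 2 * \<epsilon>\<^sup>2 * n"
    using n by (simp add: power2_eq_square)
  finally show ?thesis .
qed

text \<open>The weights \<open>\<mu> n\<close> concentrate at j = r n, where f j is about c (r
  n)^(-\<alpha>), so this value can be pulled out of the sum and leaves the total mass, of order
  n^(-\<beta>). Domination by twice a binomial weight covers all the uses below: squared weights,
  weights restricted to even j, and such weights doubled.\<close>

lemma binomial_average_tendsto:
  fixes \<mu> :: "nat \<Rightarrow> nat \<Rightarrow> real" and f :: "nat \<Rightarrow> real" and r c d \<alpha> \<beta> :: real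
  assumes r: "0 < r" "r \<le> 1"
    and mu_nonneg: "\<And>n j. j \<le> n \<Longrightarrow> 0 \<le> \<mu> n j"
    and mu_le: "\<And>n j. j \<le> n \<Longrightarrow> \<mu> n j \<le> 2 * (real (n choose j) * r ^ j * (1 - r) ^ (n - j))"
    and f: "\<And>j. 0 \<le> f j" "\<And>j. f j \<le> 1"
    and lim_f: "(\<lambda>j. f j * real j powr \<alpha>) \<longlonglongrightarrow> c"
    and lim_mu: "(\<lambda>n. (\<Sum>j\<le>n. \<mu> n j) * real n powr \<beta>) \<longlonglongrightarrow> d"
  shows "(\<lambda>n. (\<Sum>j\<le>n. \<mu> n j * f j) * real n powr (\<alpha> + \<beta>)) \<longlonglongrightarrow> d * c * r powr - \<alpha>"
proof -
  define L where "L = c * r powr - \<alpha>"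
  define T where "T n = (\<Sum>j\<le>n. \<mu> n j) * real n powr \<beta>" for n
  define E where "E n = (\<Sum>j\<le>n. \<mu> n j * f j) * real n powr (\<alpha> + \<beta>) - T n * L" for n
  \<comment> \<open>Hoeffding confines j to a window around r n; outside of it the exponential tail beats all
    powers of n.\<close>
  have window: "\<exists>\<epsilon>>0. \<forall>\<^sub>F n in sequentially. \<forall>j\<le>n. \<bar>real j - r * real n\<bar> < \<epsilon> * real n \<longrightarrow>
      \<bar>f j * real n powr \<alpha> - L\<bar> < e" if e: "e > 0" for e
  proof -
    \<comment> \<open>Joint continuity of y t^(-\<alpha>) at (c, r) is used with y = f j *
      j^\<alpha> and t = j / n, for which the product is exactly f j * n^\<alpha>.\<close>
    have "((\<lambda>z. fst z * snd z powr - \<alpha>) \<longlongrightarrow> L) (nhds c \<times>\<^sub>F nhds r)"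
      unfolding L_def using r 
      by (intro tendsto_intros filterlim_fst filterlim_snd) auto
    from tendstoD[OF this e] obtain P Q where P: "eventually P (nhds c)" and Q: "eventually Q (nhds r)"
      and PQ: "\<And>y t. P y \<Longrightarrow> Q t \<Longrightarrow> dist (y * t powr - \<alpha>) L < e"
      by (auto simp: eventually_prod_filter)
    obtain \<eta> where \<eta>: "\<eta> > 0" "\<And>t. dist t r < \<eta> \<Longrightarrow> Q t"
      using Q unfolding eventually_nhds_metric by blast
    \<comment> \<open>The cap r / 2 forces j > r n / 2 inside the window, so j grows with n and
      \<open>lim_f\<close> applies.\<close>
    define \<epsilon> where "\<epsilon> = min \<eta> (r / 2)"
    have eps: "\<epsilon> > 0" "\<epsilon> \<le> \<eta>" "\<epsilon> \<le> r / 2" using \<eta> r by (auto simp: \<epsilon>_def)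
    have "eventually (\<lambda>j. P (f j * real j powr \<alpha>)) sequentially"
      using lim_f P by (simp add: filterlim_iff)
    then obtain J where J: "\<And>j. j \<ge> J \<Longrightarrow> P (f j * real j powr \<alpha>)"
      by (auto simp: eventually_sequentially)
    have "filterlim (\<lambda>n. r / 2 * real n) at_top sequentially" using r by real_asymp
    then have "\<forall>\<^sub>F n in sequentially. r / 2 * real n \<ge> real J"
      by (simp add: filterlim_at_top)
    then have "\<forall>\<^sub>F n in sequentially. \<forall>j\<le>n. \<bar>real j - r * real n\<bar> < \<epsilon> * real n \<longrightarrow>
      \<bar>f j * real n powr \<alpha> - L\<bar> < e"
      using eventually_gt_at_top[of 0]
    proof eventually_elim
      case (elim n)
      show ?case
      proof (intro allI impI)
        fix j assume j: "j \<le> n" "\<bar>real j - r * n\<bar> < \<epsilon> * n"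
        have en: "\<epsilon> * n \<le> r / 2 * n" "\<epsilon> * n \<le> \<eta> * n"
          using mult_right_mono[OF eps(3), of n] mult_right_mono[OF eps(2), of n] by simp_all
        have "r / 2 * n < real j" using j en by (simp add: abs_if split: if_splits)
        with elim have jJ: "j \<ge> J" by linarith
        have jpos: "real j > 0" by (rule le_less_trans[OF _ \<open>r / 2 * n < real j\<close>]) (use r in simp)
        have "\<bar>real j / n - r\<bar> = \<bar>real j - r * n\<bar> / n"
          using elim by (simp add: abs_if divide_simps mult.commute)
        also have "\<dots> < \<eta>" using less_le_trans[OF j(2) en(2)] elim by (simp add: divide_less_eq)
        finally have "Q (real j / n)" by (intro \<eta>) (simp add: dist_real_def)
        have "real j powr \<alpha> * (real j / n) powr - \<alpha> = real n powr \<alpha>"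
          using jpos elim by (simp add: powr_divide powr_minus_divide)
        with PQ[OF J[OF jJ] \<open>Q (real j / n)\<close>]
        show "\<bar>f j * real n powr \<alpha> - L\<bar> < e"
          by (simp add: dist_real_def mult.assoc)
      qed
    qed
    with eps(1) show ?thesis by (intro exI[of _ \<epsilon>] conjI)
  qed
  have T: "T \<longlonglongrightarrow> d" using lim_mu by (simp add: T_def [abs_def])
  have T_nonneg: "T n \<ge> 0" for n unfolding T_def by (intro mult_nonneg_nonneg sum_nonneg mu_nonneg) auto
  have d: "d \<ge> 0" by (rule LIMSEQ_le_const[OF T]) (use T_nonneg in auto)
  have "E \<longlonglongrightarrow> 0"
  proof (rule tendstoI)
    fix e :: real assume e: "e > 0"
    \<comment> \<open>The window contributes at most \<open>T n * e'\<close>, eventually below (d +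
      1) e' = e / 2. Using d + 1 keeps the denominator positive even if d = 0.\<close>
    define e' where "e' = e / (2 * (d + 1))"
    have e': "e' > 0" using e d by (simp add: e'_def)
    obtain \<epsilon> where eps: "\<epsilon> > 0" and win: "\<forall>\<^sub>F n in sequentially. \<forall>j\<le>n. \<bar>real j - r * real n\<bar> < \<epsilon> * real n \<longrightarrow>
      \<bar>f j * real n powr \<alpha> - L\<bar> < e'" using window[OF e'] by (elim exE conjE)
    have decay: "(\<lambda>n. exp (- a * real n) * real n powr \<gamma>) \<longlonglongrightarrow> 0" if "a > 0" for a \<gamma> :: real
      using that by real_asymp
    \<comment> \<open>The 4 is the factor 2 of \<open>mu_le\<close> times the factor 2 of the
      Hoeffding bound.\<close>
    have "(\<lambda>n. 4 * (exp (- (2 * \<epsilon>\<^sup>2) * real n) * real n powr (\<beta> + \<alpha>))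
        + 4 * \<bar>L\<bar> * (exp (- (2 * \<epsilon>\<^sup>2) * real n) * real n powr \<beta>)) \<longlonglongrightarrow> 4 * 0 + 4 * \<bar>L\<bar> * 0"
      using eps by (intro tendsto_intros decay) simp_all
    then have "(\<lambda>n. 4 * exp (- 2 * \<epsilon>\<^sup>2 * real n) * real n powr \<beta> * (real n powr \<alpha> + \<bar>L\<bar>)) \<longlonglongrightarrow> 0"
      by (simp add: powr_add algebra_simps)
    then have tail: "\<forall>\<^sub>F n in sequentially. 4 * exp (- 2 * \<epsilon>\<^sup>2 * real n) * real n powr \<beta> * (real n powr \<alpha> + \<bar>L\<bar>) < e / 2"
      by (rule order_tendstoD) (use e in simp)
    have "\<forall>\<^sub>F n in sequentially. T n < d + 1" using T by (rule order_tendstoD) auto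
    then show "\<forall>\<^sub>F n in sequentially. dist (E n) 0 < e"
      using win tail eventually_gt_at_top[of 0]
    proof eventually_elim
      case (elim n)
      let ?far = "{j. j \<le> n \<and> \<epsilon> * n \<le> \<bar>real j - r * n\<bar>}"
      let ?B = "\<lambda>j. real (n choose j) * r ^ j * (1 - r) ^ (n - j)"
      have "E n = (\<Sum>j\<le>n. \<mu> n j * n powr \<beta> * (f j * n powr \<alpha> - L))"
        unfolding E_def T_def by (simp add: powr_add sum_distrib_right sum_distrib_left sum_subtractf algebra_simps)
      also have "\<bar>\<dots>\<bar> \<le> (\<Sum>j\<le>n. \<bar>\<mu> n j * n powr \<beta> * (f j * n powr \<alpha> - L)\<bar>)"
        by (rule sum_abs)
      \<comment> \<open>Inside the window the bound e' holds; outside only f \<le> 1 is used. The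
        first summand is kept for every j so that it adds up to \<open>T n * e'\<close>.\<close>
      also have "\<dots> \<le> (\<Sum>j\<le>n. \<mu> n j * n powr \<beta> * e' +
          (if \<epsilon> * n \<le> \<bar>real j - r * n\<bar> then 2 * ?B j * (n powr \<beta> * (n powr \<alpha> + \<bar>L\<bar>)) else 0))"
      proof (rule sum_mono)
        fix j assume "j \<in> {..n}"
        then have j: "j \<le> n" by simp
        have eq: "\<bar>\<mu> n j * n powr \<beta> * (f j * n powr \<alpha> - L)\<bar> = \<mu> n j * n powr \<beta> * \<bar>f j * n powr \<alpha> - L\<bar>"
          using mu_nonneg[OF j] by (simp add: abs_mult)
        show "\<bar>\<mu> n j * n powr \<beta> * (f j * n powr \<alpha> - L)\<bar> \<le> \<mu> n j * n powr \<beta> * e' +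
          (if \<epsilon> * n \<le> \<bar>real j - r * n\<bar> then 2 * ?B j * (n powr \<beta> * (n powr \<alpha> + \<bar>L\<bar>)) else 0)"
        proof (cases "\<epsilon> * n \<le> \<bar>real j - r * n\<bar>")
          case False
          then have "\<bar>f j * n powr \<alpha> - L\<bar> \<le> e'" using elim j by fastforce
          then show ?thesis unfolding eq using False mu_nonneg[OF j] by (auto intro!: mult_left_mono)
        next
          case True
          have "\<bar>f j * n powr \<alpha> - L\<bar> \<le> f j * n powr \<alpha> + \<bar>L\<bar>"
            using f(1)[of j] by (intro order.trans[OF abs_triangle_ineq4]) (simp add: abs_mult)
          also have "\<dots> \<le> n powr \<alpha> + \<bar>L\<bar>" 
            using f[of j] mult_right_mono[of "f j" 1 "n powr \<alpha>"] by simp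
          finally have "\<mu> n j * n powr \<beta> * \<bar>f j * n powr \<alpha> - L\<bar> \<le> 2 * ?B j * n powr \<beta> * (n powr \<alpha> + \<bar>L\<bar>)"
            using mu_nonneg[OF j] mu_le[OF j] by (intro mult_mono) auto
          moreover have "\<mu> n j * n powr \<beta> * e' \<ge> 0" using mu_nonneg[OF j] e' by simp
          ultimately show ?thesis unfolding eq using True by (simp add: mult.assoc)
        qed
      qed
      also have "\<dots> = T n * e' + 2 * (\<Sum>j\<in>?far. ?B j) * (n powr \<beta> * (n powr \<alpha> + \<bar>L\<bar>))"
      proof -
        have "{j \<in> {..n}. \<epsilon> * n \<le> \<bar>real j - r * n\<bar>} = ?far" by auto
        then show ?thesis
          unfolding T_def sum.distrib sum.inter_filter[symmetric, OF finite_atMost]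
          by (simp only: sum_distrib_left sum_distrib_right)
      qed
      also have "\<dots> \<le> T n * e' + 2 * (2 * exp (- 2 * \<epsilon>\<^sup>2 * n)) * (n powr \<beta> * (n powr \<alpha> + \<bar>L\<bar>))"
        using binomial_tail_bound[of r \<epsilon> n] r eps elim
        by (intro add_left_mono mult_right_mono mult_left_mono) auto
      also have "\<dots> < (d + 1) * e' + e / 2"
        using elim e' by (intro add_less_le_mono mult_strict_right_mono) (auto simp: mult_ac)
      also have "\<dots> = e" using d by (simp add: e'_def field_simps)
      finally show ?case by (simp add: dist_real_def)
    qed
  qed
  from tendsto_add[OF this tendsto_mult[OF T tendsto_const[of L]]]
  show ?thesis by (simp add: E_def L_def mult_ac)
qed

section \<open>Squared binomial coefficients\<close>

text \<open>An exact finite form of the link to Wallis's product. Passing from m to m + 1 multiplies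
  the normalised coefficient by (2m+1)/(2m+2) and the product by 4(m+1)^2/((2m+1)(2m+3)); the change
  of 2m+1 into 2m+3 compensates.\<close>

lemma central_binomial_sq_wallis:
  "(real (2 * m choose m) / 4 ^ m)\<^sup>2 * (2 * real m + 1) * (\<Prod>k=1..m. (4 * real k ^ 2) / (4 * real k ^ 2 - 1)) = 1"
proof (induction m)
  case 0
  then show ?case by simp
next
  case (Suc m)
  let ?x = "real m"
  let ?P = "\<Prod>k=1..m. (4 * real k ^ 2) / (4 * real k ^ 2 - 1)"
  have "Suc m * (2 * Suc m choose Suc m) = 2 * (2 * m + 1) * (2 * m choose m)"
  proof -
    have "Suc m * (Suc (2 * m) choose m) = (2 * m + 1) * (2 * m choose m)"
      using Suc_times_binomial[of m "2 * m"] binomial_symmetric[of m "Suc (2 * m)"] by simp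
    moreover have "Suc m * (2 * Suc m choose Suc m) = 2 * (Suc m * (Suc (2 * m) choose m))"
      using Suc_times_binomial[of m "Suc (2 * m)"] by simp
    ultimately show ?thesis by simp
  qed
  then have "real (Suc m) * real (2 * Suc m choose Suc m) = real (2 * (2 * m + 1)) * real (2 * m choose m)"
    by (simp only: of_nat_mult[symmetric])
  then have *: "real (2 * Suc m choose Suc m) = 2 * (2 * ?x + 1) / (?x + 1) * real (2 * m choose m)"
    by (simp add: field_simps del: binomial_Suc_Suc)
  have "real (2 * Suc m choose Suc m) / 4 ^ Suc m = (2 * ?x + 1) / (2 * (?x + 1)) * (real (2 * m choose m) / 4 ^ m)"
  proof -
    have "2 * s / t * c / (4 * e) = s / (2 * t) * (c / e)" for s t c e :: real by (simp add: mult.commute)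
    with * show ?thesis by (simp only: power_Suc)
  qed
  then have e1: "(real (2 * Suc m choose Suc m) / 4 ^ Suc m)\<^sup>2 = ((2 * ?x + 1) / (2 * (?x + 1)))\<^sup>2 * (real (2 * m choose m) / 4 ^ m)\<^sup>2"
    by (simp only: power_mult_distrib)
  have e2: "(\<Prod>k=1..Suc m. (4 * real k ^ 2) / (4 * real k ^ 2 - 1)) = ?P * (4 * (?x + 1)\<^sup>2 / ((2 * ?x + 1) * (2 * ?x + 3)))"
    by (simp add: algebra_simps power2_eq_square)
  have e3: "((2 * ?x + 1) / (2 * (?x + 1)))\<^sup>2 * (2 * real (Suc m) + 1) * (4 * (?x + 1)\<^sup>2 / ((2 * ?x + 1) * (2 * ?x + 3))) = 2 * ?x + 1"
  proof -
    have "2 * ?x + 1 \<noteq> 0" "2 * ?x + 3 \<noteq> 0" "?x + 1 \<noteq> 0" by (smt (verit) of_nat_0_le_iff)+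
    then show ?thesis by (simp add: divide_simps power2_eq_square) (simp add: algebra_simps)
  qed
  \<comment> \<open>The regrouping brings together the squared ratio, the new odd factor and the new
    Wallis factor, which by \<open>e3\<close> multiply to the old odd factor.\<close>
  have "x * s' * (P * w) = (y * s' * w) * (z * P)" if "x = y * z" for x y z s' w P :: real
    using that by simp
  from this[OF e1] show ?case
    unfolding e2 by (simp only: e3) (use Suc.IH in \<open>simp only: mult_ac\<close>)
qed

text \<open>By the preceding identity the square is m / (2m + 1) divided by the partial Wallis
  product, which tends to (1/2) / (pi/2) = 1/pi.\<close>

lemma central_binomial_tendsto:
  "(\<lambda>m. real (2 * m choose m) / 4 ^ m * sqrt (real m)) \<longlonglongrightarrow> 1 / sqrt pi"
proof -
  define P where "P m = (\<Prod>k=1..m. (4 * real k ^ 2) / (4 * real k ^ 2 - 1))" for m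
  have "(\<lambda>m. real m / (2 * real m + 1)) \<longlonglongrightarrow> 1 / 2" by real_asymp
  moreover have "(\<lambda>m. inverse (P m)) \<longlonglongrightarrow> inverse (pi / 2)"
    using wallis unfolding P_def by (rule tendsto_inverse) simp
  ultimately have "(\<lambda>m. sqrt (real m / (2 * real m + 1) * inverse (P m))) \<longlonglongrightarrow> sqrt (1 / 2 * inverse (pi / 2))"
    by (intro tendsto_real_sqrt tendsto_mult)
  moreover have "real (2 * m choose m) / 4 ^ m * sqrt (real m) = sqrt (real m / (2 * real m + 1) * inverse (P m))" for m
  proof -
    define q where "q = real (2 * m choose m) / 4 ^ m"
    have "q\<^sup>2 * (2 * real m + 1) * P m = 1"
      using central_binomial_sq_wallis[of m] by (simp add: P_def q_def)
    moreover from this have "P m \<noteq> 0" "2 * real m + 1 \<noteq> 0" by auto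
    ultimately have "q\<^sup>2 * real m = real m / (2 * real m + 1) * inverse (P m)"
      by (simp add: divide_simps mult_ac)
    moreover have "q \<ge> 0" by (simp add: q_def)
    ultimately have "sqrt (real m / (2 * real m + 1) * inverse (P m)) = q * sqrt (real m)"
      by (metis real_sqrt_mult real_sqrt_unique)
    then show ?thesis by (simp add: q_def)
  qed
  ultimately show ?thesis by (simp add: real_sqrt_divide)
qed

lemma sum_even_atMost:
  fixes g :: "nat \<Rightarrow> 'a::comm_monoid_add"
  shows "(\<Sum>i\<le>n. if even i then g i else 0) = (\<Sum>m\<le>n div 2. g (2 * m))"
proof -
  have "{i \<in> {..n}. even i} = (\<lambda>m. 2 * m) ` {..n div 2}" by (auto elim!: evenE)
  then show ?thesis
    by (simp add: sum.inter_filter[symmetric] sum.reindex inj_on_def)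
qed

text \<open>With r = k - 2m - l, both sides are the multinomial coefficient k! / (m! m! l!
  r!).\<close>

lemma choose_choose_choose:
  assumes "m + l + m \<le> (k::nat)"
  shows "(k choose (m + l)) * ((m + l) choose m) * ((k - (m + l)) choose m)
    = (k choose (2 * m)) * (2 * m choose m) * ((k - 2 * m) choose l)"
proof -
  obtain r where k: "k = m + l + m + r" using assms le_Suc_ex by blast
  have "k - (m + l) = m + r" "k - 2 * m = l + r" "k = 2 * m + (l + r)" by (simp_all add: k)
  then have "real ((k choose (m + l)) * ((m + l) choose m) * ((k - (m + l)) choose m))
    = real ((k choose (2 * m)) * (2 * m choose m) * ((k - 2 * m) choose l))"
    by (simp add: binomial_fact k)
  then show ?thesis by (simp only: of_nat_eq_iff)
qed

text \<open>The squared coefficient counts pairs (S, T) of j-subsets of a k-set. Group them by m =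
  |S - T| = |T - S|: the 2m positions where S and T differ give (x y)^m, and each other position
  lies in both sets (x) or in neither (y), which gives (x + y)^(k - 2m).\<close>

lemma sum_square_binomial:
  fixes x y :: real
  shows "(\<Sum>j\<le>k. (real (k choose j))\<^sup>2 * x ^ j * y ^ (k - j))
    = (\<Sum>m\<le>k div 2. real (k choose (2 * m)) * real (2 * m choose m) * (x * y) ^ m * (x + y) ^ (k - 2 * m))"
proof -
  have "(\<Sum>j\<le>k. (real (k choose j))\<^sup>2 * x ^ j * y ^ (k - j))
    = (\<Sum>j\<le>k. \<Sum>m\<le>j. real ((k choose j) * (j choose m) * ((k - j) choose m)) * x ^ j * y ^ (k - j))"
  proof (intro sum.cong refl)
    fix j assume "j \<in> {..k}"
    then have j: "j \<le> k" by simp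
    have "(\<Sum>m\<le>j. (j choose m) * ((k - j) choose m)) = (\<Sum>m\<le>j. ((k - j) choose m) * (j choose (j - m)))"
      by (intro sum.cong refl) (simp add: binomial_symmetric[symmetric] mult.commute)
    also have "\<dots> = k choose j" using vandermonde[of "k - j" j j] j by simp
    finally have "(real (k choose j))\<^sup>2 = real (\<Sum>m\<le>j. (k choose j) * (j choose m) * ((k - j) choose m))"
      by (simp only: sum_distrib_left[symmetric] mult.assoc power2_eq_square of_nat_mult)
    then show "(real (k choose j))\<^sup>2 * x ^ j * y ^ (k - j)
      = (\<Sum>m\<le>j. real ((k choose j) * (j choose m) * ((k - j) choose m)) * x ^ j * y ^ (k - j))"
      by (simp only: of_nat_sum sum_distrib_right)
  qed
  also have "\<dots> = (\<Sum>(j, m)\<in>(SIGMA j:{..k}. {..j}). real ((k choose j) * (j choose m) * ((k - j) choose m)) * x ^ j * y ^ (k - j))"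
    by (subst sum.Sigma) auto
  finally have start: "(\<Sum>j\<le>k. (real (k choose j))\<^sup>2 * x ^ j * y ^ (k - j)) = \<dots>" .
  have choose_eq: "(k choose (2 * m)) * (2 * m choose m) * ((k - 2 * m) choose (j - m))
      = (k choose j) * (j choose m) * ((k - j) choose m)" if "m \<le> j" "j + m \<le> k" for j m
    using choose_choose_choose[of m "j - m" k] that by simp
  \<comment> \<open>Terms with j + m > k vanish; on the others l = j - m counts the positions common
    to both sets.\<close>
  have middle: "(\<Sum>(j, m)\<in>(SIGMA j:{..k}. {..j}). real ((k choose j) * (j choose m) * ((k - j) choose m)) * x ^ j * y ^ (k - j))
    = (\<Sum>(m, l)\<in>(SIGMA m:{..k div 2}. {..k - 2 * m}).
      real ((k choose (2 * m)) * (2 * m choose m) * ((k - 2 * m) choose l)) * x ^ (m + l) * y ^ (k - (m + l)))"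
  proof (rule sum.mono_neutral_cong_right[THEN trans])
    let ?S = "{(j, m). m \<le> j \<and> j + m \<le> k}"
    show "finite (SIGMA j:{..k}. {..j})" by auto
    show "?S \<subseteq> (SIGMA j:{..k}. {..j})" by auto
    show "\<forall>i\<in>(SIGMA j:{..k}. {..j}) - ?S. (case i of (j, m) \<Rightarrow> real ((k choose j) * (j choose m) * ((k - j) choose m)) * x ^ j * y ^ (k - j)) = 0"
      by (auto simp: binomial_eq_0)
    show "(\<Sum>(j, m)\<in>?S. real ((k choose j) * (j choose m) * ((k - j) choose m)) * x ^ j * y ^ (k - j)) =
      (\<Sum>(m, l)\<in>(SIGMA m:{..k div 2}. {..k - 2 * m}).
      real ((k choose (2 * m)) * (2 * m choose m) * ((k - 2 * m) choose l)) * x ^ (m + l) * y ^ (k - (m + l)))"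
      by (rule sum.reindex_bij_witness[where j = "\<lambda>(j, m). (m, j - m)" and i = "\<lambda>(m, l). (m + l, m)"])
        (auto simp: choose_eq simp flip: of_nat_mult)
  qed auto
  note start also note middle
  also have "\<dots> = (\<Sum>m\<le>k div 2. \<Sum>l\<le>k - 2 * m.
      real ((k choose (2 * m)) * (2 * m choose m) * ((k - 2 * m) choose l)) * x ^ (m + l) * y ^ (k - (m + l)))"
    by (subst sum.Sigma) auto
  also have "\<dots> = (\<Sum>m\<le>k div 2. real (k choose (2 * m)) * real (2 * m choose m) * (x * y) ^ m * (x + y) ^ (k - 2 * m))"
  proof (intro sum.cong refl)
    fix m assume "m \<in> {..k div 2}"
    then have m: "2 * m \<le> k" by auto
    have "k - (m + l) = m + (k - 2 * m - l)" if "l \<le> k - 2 * m" for l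
      using that m by auto
    then show "(\<Sum>l\<le>k - 2 * m. real ((k choose (2 * m)) * (2 * m choose m) * ((k - 2 * m) choose l)) * x ^ (m + l) * y ^ (k - (m + l)))
      = real (k choose (2 * m)) * real (2 * m choose m) * (x * y) ^ m * (x + y) ^ (k - 2 * m)"
      unfolding binomial_ring sum_distrib_left
      by (intro sum.cong refl) (simp add: power_add power_mult_distrib mult_ac)
  qed
  finally show ?thesis .
qed

section \<open>Pairs of words with equal content\<close>

text \<open>The sum of the squares of all multinomial coefficients of k with N parts, computed by splitting
  off the last part.\<close>

primrec multinomial_sq :: "nat \<Rightarrow> nat \<Rightarrow> nat" where
  "multinomial_sq 0 k = (if k = 0 then 1 else 0)"
| "multinomial_sq (Suc N) k = (\<Sum>m\<le>k. (k choose m)\<^sup>2 * multinomial_sq N m)"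

text \<open>Positions outside C are unconstrained. This will separate the boundary of a set from the
  positions at which b is free.\<close>

lemma card_PiE_Un_restrict:
  assumes "C \<inter> D = {}" "finite D"
  shows "card {b \<in> C \<union> D \<rightarrow>\<^sub>E Y. Q (restrict b C)} = card {b \<in> C \<rightarrow>\<^sub>E Y. Q b} * card Y ^ card D"
proof -
  let ?glue = "\<lambda>(f, g) x. if x \<in> C then f x else g x"
  have "bij_betw (\<lambda>b. (restrict b C, restrict b D))
      {b \<in> C \<union> D \<rightarrow>\<^sub>E Y. Q (restrict b C)} ({b \<in> C \<rightarrow>\<^sub>E Y. Q b} \<times> (D \<rightarrow>\<^sub>E Y))"
  proof (rule bij_betw_byWitness[where f' = ?glue])
    have [simp]: "(\<lambda>x\<in>C. if x \<in> C then f x else g x) = f" "(\<lambda>x\<in>D. if x \<in> C then f x else g x) = g"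
      if "f \<in> C \<rightarrow>\<^sub>E Y" "g \<in> D \<rightarrow>\<^sub>E Y" for f g
      using that assms(1) by (auto simp: fun_eq_iff PiE_def extensional_def restrict_def)
    show "\<forall>b\<in>{b \<in> C \<union> D \<rightarrow>\<^sub>E Y. Q (restrict b C)}. ?glue (restrict b C, restrict b D) = b"
      by (auto simp: fun_eq_iff PiE_def extensional_def)
    show "\<forall>fg\<in>{b \<in> C \<rightarrow>\<^sub>E Y. Q b} \<times> (D \<rightarrow>\<^sub>E Y). (restrict (?glue fg) C, restrict (?glue fg) D) = fg"
      by auto
    show "(\<lambda>b. (restrict b C, restrict b D)) ` {b \<in> C \<union> D \<rightarrow>\<^sub>E Y. Q (restrict b C)}
      \<subseteq> {b \<in> C \<rightarrow>\<^sub>E Y. Q b} \<times> (D \<rightarrow>\<^sub>E Y)"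
      by auto
    show "?glue ` ({b \<in> C \<rightarrow>\<^sub>E Y. Q b} \<times> (D \<rightarrow>\<^sub>E Y)) \<subseteq> {b \<in> C \<union> D \<rightarrow>\<^sub>E Y. Q (restrict b C)}"
    proof (rule image_subsetI)
      fix fg assume "fg \<in> {b \<in> C \<rightarrow>\<^sub>E Y. Q b} \<times> (D \<rightarrow>\<^sub>E Y)"
      then obtain f g where fg: "fg = (f, g)" "f \<in> C \<rightarrow>\<^sub>E Y" "g \<in> D \<rightarrow>\<^sub>E Y" "Q f" by blast
      then have "(\<lambda>x. if x \<in> C then f x else g x) \<in> C \<union> D \<rightarrow>\<^sub>E Y"
        by (auto simp: PiE_def extensional_def)
      with fg show "?glue fg \<in> {b \<in> C \<union> D \<rightarrow>\<^sub>E Y. Q (restrict b C)}" by simp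
    qed
  qed
  from bij_betw_same_card[OF this] show ?thesis
    using assms(2) by (simp add: card_cartesian_product card_funcsetE)
qed

lemma image_mset_restrict_cong:
  assumes "A \<subseteq> C"
  shows "image_mset (restrict b C) (mset_set A) = image_mset b (mset_set A)"
proof (rule image_mset_cong)
  fix x assume "x \<in># mset_set A"
  then have "x \<in> A" by (cases "finite A") auto
  with assms show "restrict b C x = b x" by auto
qed

lemma image_mset_split_top:
  assumes "finite A" "b ` A \<subseteq> {0..<Suc N}"
  shows "image_mset b (mset_set A)
    = image_mset b (mset_set {y \<in> A. b y < N}) + replicate_mset (card {y \<in> A. \<not> b y < N}) N"
proof -
  have A: "mset_set A = mset_set {y \<in> A. b y < N} + mset_set {y \<in> A. \<not> b y < N}"
    by (subst mset_set_Union[symmetric]) (use assms(1) in \<open>auto intro!: arg_cong[where f = mset_set]\<close>)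
  have "image_mset b (mset_set {y \<in> A. \<not> b y < N}) = image_mset (\<lambda>_. N) (mset_set {y \<in> A. \<not> b y < N})"
    by (rule image_mset_cong) (use assms in \<open>auto simp: less_Suc_eq\<close>)
  then show ?thesis by (subst A) (simp add: image_mset_const_eq)
qed

text \<open>Since A and B have equal size, agreement on the letters below N already forces equally
  many occurrences of the top letter N.\<close>

lemma image_mset_eq_split_top_iff:
  assumes "finite A" "finite B" "b ` A \<subseteq> {0..<Suc N}" "b ` B \<subseteq> {0..<Suc N}" "card A = card B"
  shows "image_mset b (mset_set A) = image_mset b (mset_set B) \<longleftrightarrow>
    image_mset b (mset_set {y \<in> A. b y < N}) = image_mset b (mset_set {y \<in> B. b y < N})" (is "?l \<longleftrightarrow> ?r")
proof
  assume ?l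
  have filter: "filter_mset (\<lambda>x. x < N) (image_mset b (mset_set S)) = image_mset b (mset_set {y \<in> S. b y < N})"
    if "finite S" for S
    using that by (simp add: filter_mset_image_mset filter_mset_mset_set)
  from \<open>?l\<close> have "filter_mset (\<lambda>x. x < N) (image_mset b (mset_set A)) = filter_mset (\<lambda>x. x < N) (image_mset b (mset_set B))"
    by simp
  then show ?r by (simp only: filter assms)
next
  assume r: ?r
  have "card {y \<in> S. b y < N} + card {y \<in> S. \<not> b y < N} = card S" if "finite S" for S
    using that by (subst card_Un_disjoint[symmetric]) (auto intro!: arg_cong[where f = card])
  from this[OF assms(1)] this[OF assms(2)]
  have "card {y \<in> A. b y < N} + card {y \<in> A. \<not> b y < N} = card {y \<in> B. b y < N} + card {y \<in> B. \<not> b y < N}"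
    using assms(5) by simp
  moreover have "card {y \<in> A. b y < N} = card {y \<in> B. b y < N}"
    using arg_cong[OF r, of size] by simp
  ultimately have "card {y \<in> A. \<not> b y < N} = card {y \<in> B. \<not> b y < N}"
    by linarith
  with r show ?l using image_mset_split_top[of A b N] image_mset_split_top[of B b N] assms by simp
qed

lemma sum_Pow_card:
  assumes "finite A"
  shows "(\<Sum>J\<in>Pow A. g (card J)) = (\<Sum>m\<le>card A. (card A choose m) * (g m :: nat))"
proof -
  have "(\<Sum>J\<in>Pow A. g (card J)) = (\<Sum>m\<le>card A. \<Sum>J | J \<in> Pow A \<and> card J = m. g (card J))"
    by (rule sum.group[symmetric]) (use assms in \<open>auto intro: card_mono\<close>)
  also have "\<dots> = (\<Sum>m\<le>card A. (card A choose m) * g m)"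
    using n_subsets[OF assms] by (intro sum.cong refl) (simp add: Pow_def)
  finally show ?thesis .
qed

text \<open>Induction on the alphabet: let J and J' be the positions in A and B that carry letters
  below N. Equal content forces |J| = |J'| = m. There are (k choose m)^2 such pairs, with k = |A|,
  and the words on J and J' are counted by the induction hypothesis.\<close>

lemma card_PiE_image_mset_eq:
  assumes "finite A" "finite B" "A \<inter> B = {}" "card A = card B"
  shows "card {b \<in> A \<union> B \<rightarrow>\<^sub>E {0..<N}. image_mset b (mset_set A) = image_mset b (mset_set B)}
    = multinomial_sq N (card A)"
  using assms
proof (induction N arbitrary: A B)
  case 0
  show ?case
  proof (cases "A = {}")
    case True
    with 0 show ?thesis by simp
  next
    case False
    then have "A \<union> B \<rightarrow>\<^sub>E {0..<0::nat} = {}" by (auto simp: PiE_eq_empty_iff)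
    then have none: "{b \<in> A \<union> B \<rightarrow>\<^sub>E {0..<0::nat}. image_mset b (mset_set A) = image_mset b (mset_set B)} = {}" by simp
    have "card A \<noteq> 0" using 0(1) False by simp
    then show ?thesis unfolding none by simp
  qed
next
  case (Suc N)
  let ?E = "\<lambda>N A B. {b \<in> A \<union> B \<rightarrow>\<^sub>E {0..<N}. image_mset b (mset_set A) = image_mset b (mset_set B)}"
  let ?low = "\<lambda>b. ({y \<in> A. b y < N}, {y \<in> B. b y < N})"
  have fin: "finite (?E (Suc N) A B)" using Suc.prems by (auto intro!: finite_PiE)
  have fibre: "card {b \<in> ?E (Suc N) A B. ?low b = (J, J')} = (if card J = card J' then multinomial_sq N (card J) else 0)"
    if J: "J \<subseteq> A" "J' \<subseteq> B" for J J'
  proof (cases "card J = card J'")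
    case False
    have "card {y \<in> A. b y < N} = card {y \<in> B. b y < N}" if "b \<in> ?E (Suc N) A B" for b
    proof -
      have "image_mset b (mset_set {y \<in> A. b y < N}) = image_mset b (mset_set {y \<in> B. b y < N})"
        using that Suc.prems by (subst image_mset_eq_split_top_iff[symmetric]) auto
      from arg_cong[OF this, of size] show ?thesis by simp
    qed
    then have none: "{b \<in> ?E (Suc N) A B. ?low b = (J, J')} = {}" using False by auto
    show ?thesis unfolding none using False by simp
  next
    case True
    \<comment> \<open>The inverse of restriction puts the top letter N on the remaining positions;
      \<open>undefined\<close> outside A and B keeps the function extensional.\<close>
    let ?ext = "\<lambda>b y. if y \<in> J \<union> J' then b y else if y \<in> A \<union> B then N else undefined"
    have "bij_betw (\<lambda>b. restrict b (J \<union> J')) {b \<in> ?E (Suc N) A B. ?low b = (J, J')} (?E N J J')"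
    proof (rule bij_betw_byWitness[where f' = ?ext])
      show "\<forall>b\<in>{b \<in> ?E (Suc N) A B. ?low b = (J, J')}. ?ext (restrict b (J \<union> J')) = b"
      proof (intro ballI ext)
        fix b y assume b: "b \<in> {b \<in> ?E (Suc N) A B. ?low b = (J, J')}"
        then have "b \<in> A \<union> B \<rightarrow>\<^sub>E {0..<Suc N}" "J = {y \<in> A. b y < N}" "J' = {y \<in> B. b y < N}" by auto
        then show "?ext (restrict b (J \<union> J')) y = b y"
          by (auto simp: PiE_def extensional_def Pi_def less_Suc_eq)
      qed
      show "\<forall>b\<in>?E N J J'. restrict (?ext b) (J \<union> J') = b"
        by (auto simp: fun_eq_iff PiE_def extensional_def)
      show "(\<lambda>b. restrict b (J \<union> J')) ` {b \<in> ?E (Suc N) A B. ?low b = (J, J')} \<subseteq> ?E N J J'"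
      proof (rule image_subsetI)
        fix b assume b: "b \<in> {b \<in> ?E (Suc N) A B. ?low b = (J, J')}"
        then have J_eq: "J = {y \<in> A. b y < N}" "J' = {y \<in> B. b y < N}" by auto
        have "image_mset b (mset_set J) = image_mset b (mset_set J')"
          unfolding J_eq using b Suc.prems by (subst image_mset_eq_split_top_iff[symmetric]) auto
        then have "image_mset (restrict b (J \<union> J')) (mset_set J) = image_mset (restrict b (J \<union> J')) (mset_set J')"
          by (simp add: image_mset_restrict_cong)
        moreover have "restrict b (J \<union> J') \<in> J \<union> J' \<rightarrow>\<^sub>E {0..<N}" using J_eq by auto
        ultimately show "restrict b (J \<union> J') \<in> ?E N J J'" by blast
      qed
      show "?ext ` ?E N J J' \<subseteq> {b \<in> ?E (Suc N) A B. ?low b = (J, J')}"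
      proof (rule image_subsetI)
        fix b assume b: "b \<in> ?E N J J'"
        then have bN: "b y < N" if "y \<in> J \<union> J'" for y using that by (auto simp: PiE_iff)
        define c where "c = ?ext b"
        have c: "c \<in> A \<union> B \<rightarrow>\<^sub>E {0..<Suc N}"
          using J bN by (auto simp: c_def PiE_iff extensional_def less_Suc_eq)
        have low: "{y \<in> A. c y < N} = J" "{y \<in> B. c y < N} = J'"
          using J bN Suc.prems(3) by (auto simp: c_def)
        have "image_mset c (mset_set S) = image_mset b (mset_set S)" if "S \<subseteq> J \<union> J'" "finite S" for S
          using that by (intro image_mset_cong) (auto simp: c_def)
        moreover have "finite J" "finite J'" using J Suc.prems finite_subset by blast+
        ultimately have "image_mset c (mset_set {y \<in> A. c y < N}) = image_mset c (mset_set {y \<in> B. c y < N})"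
          using b low by simp
        then have "image_mset c (mset_set A) = image_mset c (mset_set B)"
          using c Suc.prems by (subst image_mset_eq_split_top_iff[of _ _ _ N]) (auto simp: PiE_iff)
        then show "?ext b \<in> {b \<in> ?E (Suc N) A B. ?low b = (J, J')}"
          using c low unfolding c_def[symmetric] by simp
      qed
    qed
    from bij_betw_same_card[OF this] show ?thesis
      using True Suc.IH[of J J'] J Suc.prems by (auto dest: finite_subset)
  qed
  have "card (?E (Suc N) A B) = (\<Sum>p\<in>Pow A \<times> Pow B. card {b \<in> ?E (Suc N) A B. ?low b = p})"
  proof -
    have "(\<Sum>p\<in>Pow A \<times> Pow B. \<Sum>b | b \<in> ?E (Suc N) A B \<and> ?low b = p. 1::nat) = (\<Sum>b\<in>?E (Suc N) A B. 1)"
      by (rule sum.group) (use fin Suc.prems in auto)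
    then show ?thesis by simp
  qed
  also have "\<dots> = (\<Sum>J\<in>Pow A. \<Sum>J'\<in>Pow B. if card J = card J' then multinomial_sq N (card J) else 0)"
    unfolding sum.cartesian_product by (intro sum.cong refl) (use fibre in auto)
  also have "\<dots> = (\<Sum>J\<in>Pow A. \<Sum>m\<le>card B. (card B choose m) * (if card J = m then multinomial_sq N (card J) else 0))"
    using Suc.prems by (intro sum.cong refl sum_Pow_card)
  also have "\<dots> = (\<Sum>J\<in>Pow A. (card A choose card J) * multinomial_sq N (card J))"
    using Suc.prems by (intro sum.cong refl) (simp add: if_distrib sum.delta card_mono cong: if_cong)
  also have "\<dots> = multinomial_sq (Suc N) (card A)"
    using Suc.prems by (subst sum_Pow_card) (auto simp: power2_eq_square mult.assoc)
  finally show ?case .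
qed

section \<open>Asymptotics of the collision probability\<close>

text \<open>The probability that two independent uniform words of length k over N letters have equal
  content: \<open>multinomial_sq N k\<close> counts such pairs among all N^(2k).\<close>

definition collision_prob :: "nat \<Rightarrow> nat \<Rightarrow> real" where
  "collision_prob N k = real (multinomial_sq N k) / real N ^ (2 * k)"

definition binomial_weight :: "nat \<Rightarrow> real \<Rightarrow> nat \<Rightarrow> real" where
  "binomial_weight n q j = real (n choose j) * q ^ j * (1 - q) ^ (n - j)"

lemma binomial_weight_nonneg: "0 \<le> q \<Longrightarrow> q \<le> 1 \<Longrightarrow> 0 \<le> binomial_weight n q j"
  by (simp add: binomial_weight_def)

lemma sum_binomial_weight: "(\<Sum>j\<le>n. binomial_weight n q j) = 1"
  using binomial_ring[of q "1 - q" n] by (simp add: binomial_weight_def)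

lemma binomial_weight_le_1:
  assumes "0 \<le> q" "q \<le> 1" "j \<le> n"
  shows "binomial_weight n q j \<le> 1"
proof -
  have "binomial_weight n q j \<le> (\<Sum>j\<le>n. binomial_weight n q j)"
    by (rule member_le_sum) (use assms binomial_weight_nonneg in auto)
  then show ?thesis by (simp add: sum_binomial_weight)
qed

lemma binomial_weight_sq_le:
  assumes "0 \<le> q" "q \<le> 1" "j \<le> n"
  shows "(binomial_weight n q j)\<^sup>2 \<le> binomial_weight n q j"
  using mult_left_mono[OF binomial_weight_le_1[OF assms] binomial_weight_nonneg[OF assms(1,2)]]
  by (simp add: power2_eq_square)

text \<open>Averaging the expansions of (q + (1 - q))^n and (-q + (1 - q))^n removes the odd
  terms.\<close>

lemma sum_even_binomial_weight:
  "(\<Sum>j\<le>n. if even j then binomial_weight n q j else 0) = (1 + (1 - 2 * q) ^ n) / 2"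
proof -
  have "(\<Sum>j\<le>n. if even j then binomial_weight n q j else 0)
      = (\<Sum>j\<le>n. (binomial_weight n q j + real (n choose j) * (- q) ^ j * (1 - q) ^ (n - j)) / 2)"
    by (intro sum.cong refl) (auto simp: binomial_weight_def uminus_power_if)
  also have "\<dots> = ((\<Sum>j\<le>n. binomial_weight n q j) + (- q + (1 - q)) ^ n) / 2"
    unfolding binomial_ring by (simp add: sum.distrib sum_divide_distrib add_divide_distrib)
  finally show ?thesis by (simp add: sum_binomial_weight algebra_simps)
qed

text \<open>The sums below run over even j with a value depending on j / 2. Rounding down extends
  that value to all j, as \<open>binomial_average_tendsto\<close> requires, and j div 2 is
  asymptotic to j / 2.\<close>

lemma tendsto_powr_halved:
  fixes g :: "nat \<Rightarrow> real"
  assumes "(\<lambda>m. g m * real m powr \<alpha>) \<longlonglongrightarrow> c"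
  shows "(\<lambda>j. g (j div 2) * real j powr \<alpha>) \<longlonglongrightarrow> c * 2 powr \<alpha>"
proof -
  have half: "filterlim (\<lambda>j::nat. j div 2) at_top sequentially"
    unfolding filterlim_at_top_ge[of _ _ 0]
  proof (intro allI impI)
    fix Z :: nat
    show "\<forall>\<^sub>F j in sequentially. Z \<le> j div 2"
      using eventually_ge_at_top[of "2 * Z"] by eventually_elim auto
  qed
  have "(\<lambda>j. real (j div 2) / real j) \<longlonglongrightarrow> 1 / 2"
  proof (rule tendsto_sandwich)
    have bounds: "(real j - 1) / 2 \<le> real (j div 2)" "real (j div 2) \<le> real j / 2" for j
      by (cases "even j"; auto elim!: evenE oddE)+
    show "\<forall>\<^sub>F j in sequentially. (real j - 1) / 2 / real j \<le> real (j div 2) / real j"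
      by (intro always_eventually allI divide_right_mono bounds) auto
    show "\<forall>\<^sub>F j in sequentially. real (j div 2) / real j \<le> real j / 2 / real j"
      by (intro always_eventually allI divide_right_mono bounds) auto
    show "(\<lambda>j. (real j - 1) / 2 / real j) \<longlonglongrightarrow> 1 / 2" by real_asymp
    show "(\<lambda>j. real j / 2 / real j) \<longlonglongrightarrow> 1 / 2" by real_asymp
  qed
  then have "(\<lambda>j. (real (j div 2) / real j) powr - \<alpha>) \<longlonglongrightarrow> (1 / 2) powr - \<alpha>"
    by (rule tendsto_powr) auto
  with filterlim_compose[OF assms half]
  have "(\<lambda>j. g (j div 2) * real (j div 2) powr \<alpha> * (real (j div 2) / real j) powr - \<alpha>) \<longlonglongrightarrow> c * (1 / 2) powr - \<alpha>"
    by (intro tendsto_mult)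
  moreover have "\<forall>\<^sub>F j in sequentially. g (j div 2) * real (j div 2) powr \<alpha> * (real (j div 2) / real j) powr - \<alpha>
      = g (j div 2) * real j powr \<alpha>"
    \<comment> \<open>From j = 2 on, j div 2 is positive and the powers of it cancel.\<close>
    using eventually_ge_at_top[of 2]
  proof eventually_elim
    case (elim j)
    then have "real (j div 2) > 0" "real j > 0" by (auto simp: div_greater_zero_iff)
    then show ?case by (simp add: powr_divide powr_minus_divide)
  qed
  ultimately have "(\<lambda>j. g (j div 2) * real j powr \<alpha>) \<longlonglongrightarrow> c * (1 / 2) powr - \<alpha>"
    by (rule Lim_transform_eventually)
  then show ?thesis by (simp add: powr_divide powr_minus_divide)
qed

text \<open>The two sequences differ at n = 0, since 0 powr 0 = 0.\<close>

lemma tendsto_mult_powr_0: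
  fixes g :: "nat \<Rightarrow> real"
  shows "(\<lambda>n. g n * real n powr 0) \<longlonglongrightarrow> c \<longleftrightarrow> g \<longlonglongrightarrow> c"
  by (rule tendsto_cong) (use eventually_gt_at_top[of 0] in \<open>eventually_elim, simp\<close>)

text \<open>The left-hand side is the probability that a sum of n differences of two Bernoulli(q) variables
  vanishes. Such a difference is nonzero with probability 2q(1 - q), and its sign is then fair.\<close>

lemma sum_binomial_weight_sq_eq:
  "(\<Sum>j\<le>n. (binomial_weight n q j)\<^sup>2)
    = (\<Sum>j\<le>n. (if even j then binomial_weight n (2 * q * (1 - q)) j else 0)
        * (real (2 * (j div 2) choose (j div 2)) / 4 ^ (j div 2)))"
proof -
  let ?v = "2 * q * (1 - q)"
  have v: "q\<^sup>2 + (1 - q)\<^sup>2 = 1 - ?v" by (simp add: power2_eq_square algebra_simps)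
  have "(\<Sum>j\<le>n. (binomial_weight n q j)\<^sup>2) = (\<Sum>j\<le>n. (real (n choose j))\<^sup>2 * (q\<^sup>2) ^ j * ((1 - q)\<^sup>2) ^ (n - j))"
    by (simp add: binomial_weight_def power_mult_distrib power_mult[symmetric] mult.commute)
  also have "\<dots> = (\<Sum>m\<le>n div 2. real (n choose (2 * m)) * real (2 * m choose m) * (q\<^sup>2 * (1 - q)\<^sup>2) ^ m * (1 - ?v) ^ (n - 2 * m))"
    by (simp only: sum_square_binomial v)
  also have "\<dots> = (\<Sum>m\<le>n div 2. binomial_weight n ?v (2 * m) * (real (2 * m choose m) / 4 ^ m))"
  proof (intro sum.cong refl)
    fix m
    have "?v ^ (2 * m) = 4 ^ m * (q\<^sup>2 * (1 - q)\<^sup>2) ^ m"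
      by (simp add: power_mult power_mult_distrib)
    then show "real (n choose (2 * m)) * real (2 * m choose m) * (q\<^sup>2 * (1 - q)\<^sup>2) ^ m * (1 - ?v) ^ (n - 2 * m)
      = binomial_weight n ?v (2 * m) * (real (2 * m choose m) / 4 ^ m)"
      unfolding binomial_weight_def by simp
  qed
  also have "\<dots> = (\<Sum>j\<le>n. if even j then binomial_weight n ?v j * (real (2 * (j div 2) choose (j div 2)) / 4 ^ (j div 2)) else 0)"
    by (subst sum_even_atMost) simp
  also have "\<dots> = (\<Sum>j\<le>n. (if even j then binomial_weight n ?v j else 0) * (real (2 * (j div 2) choose (j div 2)) / 4 ^ (j div 2)))"
    by (intro sum.cong refl) simp
  finally show ?thesis .
qed

text \<open>In the preceding identity j concentrates at v n with v = 2q(1 - q). The even j have mass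
  tending to 1/2 and the central binomial factor at j / 2 is about sqrt (2 / (pi v n)), so the sum
  is about 1 / sqrt (2 pi v n).\<close>

lemma sum_binomial_weight_sq_tendsto:
  assumes q: "0 < q" "q < 1"
  shows "(\<lambda>n. (\<Sum>j\<le>n. (binomial_weight n q j)\<^sup>2) * real n powr (1 / 2)) \<longlonglongrightarrow> 1 / sqrt (4 * pi * q * (1 - q))"
proof -
  define v where "v = 2 * q * (1 - q)"
  define f where "f m = real (2 * m choose m) / 4 ^ m" for m
  \<comment> \<open>This square equals 1 - 2v, so 1 - 2v lies in [0, 1) and its powers tend to
    0.\<close>
  have "0 \<le> (1 - 2 * q)\<^sup>2" by simp
  then have v: "0 < v" "v \<le> 1 / 2" using q by (auto simp: v_def power2_eq_square algebra_simps)
  have f_le: "f m \<le> 1" for m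
  proof -
    have "real (2 * m choose m) \<le> real (2 ^ (2 * m))"
      using binomial_le_pow2[of "2 * m" m] by (simp only: of_nat_le_iff)
    then show ?thesis by (simp add: f_def power_mult)
  qed
  have "(\<lambda>m. f m * real m powr (1 / 2)) \<longlonglongrightarrow> 1 / sqrt pi"
    using central_binomial_tendsto by (simp add: f_def powr_half_sqrt)
  then have lim_f: "(\<lambda>j. f (j div 2) * real j powr (1 / 2)) \<longlonglongrightarrow> 1 / sqrt pi * 2 powr (1 / 2)"
    by (rule tendsto_powr_halved)
  have "(\<lambda>n. (1 + (1 - 2 * v) ^ n) / 2) \<longlonglongrightarrow> (1 + 0) / 2"
    using v by (intro tendsto_intros LIMSEQ_power_zero) auto
  then have lim_mu: "(\<lambda>n. (\<Sum>j\<le>n. if even j then binomial_weight n v j else 0) * real n powr 0) \<longlonglongrightarrow> 1 / 2"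
    unfolding tendsto_mult_powr_0 sum_even_binomial_weight by simp
  have "(\<lambda>n. (\<Sum>j\<le>n. (if even j then binomial_weight n v j else 0) * f (j div 2)) * real n powr (1 / 2 + 0))
      \<longlonglongrightarrow> 1 / 2 * (1 / sqrt pi * 2 powr (1 / 2)) * v powr - (1 / 2)"
    by (rule binomial_average_tendsto[OF _ _ _ _ _ _ lim_f lim_mu])
      (use v f_le binomial_weight_nonneg[of v] in \<open>auto simp: f_def simp flip: binomial_weight_def\<close>)
  moreover have "1 / 2 * (1 / sqrt pi * 2 powr (1 / 2)) * v powr - (1 / 2) = 1 / sqrt (4 * pi * q * (1 - q))"
  proof -
    have "1 / 2 * (1 / sqrt pi * 2 powr (1 / 2)) * v powr - (1 / 2) = sqrt (1 / 4) * sqrt (1 / pi) * sqrt 2 * sqrt (1 / v)"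
      using v by (simp add: powr_half_sqrt powr_minus_divide real_sqrt_divide)
    also have "\<dots> = sqrt (1 / 4 * (1 / pi) * 2 * (1 / v))"
      by (simp only: real_sqrt_mult)
    also have "1 / 4 * (1 / pi) * 2 * (1 / v) = 1 / (4 * pi * q * (1 - q))"
      by (simp add: v_def)
    finally show ?thesis by (simp add: real_sqrt_divide)
  qed
  ultimately show ?thesis by (simp only: sum_binomial_weight_sq_eq v_def f_def add_0_right)
qed

text \<open>N / (N + 1) is the probability that a uniform letter avoids the split-off one. The
  weight is squared because both words must have the same number m of the other letters.\<close>

lemma collision_prob_Suc:
  assumes "N \<ge> 1"
  shows "collision_prob (Suc N) k
    = (\<Sum>m\<le>k. (binomial_weight k (real N / (real N + 1)) m)\<^sup>2 * collision_prob N m)"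
  unfolding collision_prob_def multinomial_sq.simps of_nat_sum sum_divide_distrib
proof (intro sum.cong refl)
  fix m assume "m \<in> {..k}"
  then obtain l where "k = m + l" using le_Suc_ex by auto
  then have "(real N + 1) ^ (2 * k) = ((real N + 1) ^ m)\<^sup>2 * ((real N + 1) ^ (k - m))\<^sup>2"
    by (simp add: distrib_left power_add power_even_eq)
  moreover have "1 - real N / (real N + 1) = 1 / (real N + 1)" by (simp add: field_simps)
  ultimately show "real ((k choose m)\<^sup>2 * multinomial_sq N m) / real (Suc N) ^ (2 * k)
     = (binomial_weight k (real N / (real N + 1)) m)\<^sup>2 * (real (multinomial_sq N m) / real N ^ (2 * m))"
    using assms by (simp add: binomial_weight_def power_divide power_mult_distrib power_even_eq add.commute)
qed

lemma multinomial_sq_1: "multinomial_sq (Suc 0) k = 1"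
  by (simp add: if_distrib cong: if_cong)

lemma collision_prob_nonneg: "0 \<le> collision_prob N k"
  by (simp add: collision_prob_def)

lemma collision_prob_le_1: "N \<ge> 1 \<Longrightarrow> collision_prob N k \<le> 1"
proof (induction N arbitrary: k rule: nat_induct_at_least)
  case base
  show ?case using multinomial_sq_1[of k] by (simp add: collision_prob_def del: multinomial_sq.simps)
next
  case (Suc N)
  let ?r = "real N / (real N + 1)"
  have r: "0 \<le> ?r" "?r \<le> 1" by auto
  have "collision_prob (Suc N) k \<le> (\<Sum>m\<le>k. binomial_weight k ?r m * 1)"
    unfolding collision_prob_Suc[OF Suc.hyps(1)]
    by (intro sum_mono mult_mono binomial_weight_sq_le Suc.IH binomial_weight_nonneg collision_prob_nonneg r) auto
  then show ?case by (simp add: sum_binomial_weight)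
qed

text \<open>Each further letter costs a factor of order k^(-1/2), the mass of the squared weights,
  while the previous asymptotics is evaluated at length r k with r = N / (N + 1).\<close>

lemma collision_prob_tendsto:
  "N \<ge> 1 \<Longrightarrow> (\<lambda>k. collision_prob N k * real k powr ((real N - 1) / 2)) \<longlonglongrightarrow> sqrt (real N ^ N / (4 * pi) ^ (N - 1))"
proof (induction N rule: nat_induct_at_least)
  case base
  have "(\<lambda>k. 1 * real k powr 0) \<longlonglongrightarrow> 1" by (simp only: tendsto_mult_powr_0 tendsto_const)
  then show ?case using multinomial_sq_1
    by (simp add: collision_prob_def del: multinomial_sq.simps)
next
  case (Suc N)
  define r where "r = real N / (real N + 1)"
  have r: "0 < r" "r < 1" using Suc.hyps by (auto simp: r_def)
  have "(\<lambda>n. (\<Sum>j\<le>n. (binomial_weight n r j)\<^sup>2 * collision_prob N j) * real n powr ((real N - 1) / 2 + 1 / 2)) \<longlonglongrightarrow>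
      1 / sqrt (4 * pi * r * (1 - r)) * sqrt (real N ^ N / (4 * pi) ^ (N - 1)) * r powr - ((real N - 1) / 2)"
  proof (rule binomial_average_tendsto[OF _ _ _ _ _ _ Suc.IH sum_binomial_weight_sq_tendsto])
    show "(binomial_weight n r j)\<^sup>2 \<le> 2 * (real (n choose j) * r ^ j * (1 - r) ^ (n - j))" if "j \<le> n" for n j
      using binomial_weight_sq_le[of r j n] binomial_weight_nonneg[of r n j] r that
      by (simp flip: binomial_weight_def)
  qed (use r Suc.hyps collision_prob_nonneg collision_prob_le_1 in auto)
  moreover have "(real N - 1) / 2 + 1 / 2 = (real (Suc N) - 1) / 2" by (simp add: field_simps)
  \<comment> \<open>Under the root, 1 / (r (1 - r)) = (N + 1)^2 / N and r^(-(N - 1)) = ((N + 1) /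
    N)^(N - 1); multiplied by N^N they give (N + 1)^(N + 1).\<close>
  moreover have "1 / sqrt (4 * pi * r * (1 - r)) * sqrt (real N ^ N / (4 * pi) ^ (N - 1)) * r powr - ((real N - 1) / 2)
      = sqrt (real (Suc N) ^ Suc N / (4 * pi) ^ (Suc N - 1))"
  proof -
    obtain M where N: "N = Suc M" using Suc.hyps by (cases N) auto
    have "r powr - ((real N - 1) / 2) = (r powr (- real M)) powr (1 / 2)"
      by (simp add: powr_powr N)
    also have "\<dots> = sqrt (1 / r ^ M)"
      using r by (simp add: powr_half_sqrt powr_minus_divide powr_realpow)
    finally have "1 / sqrt (4 * pi * r * (1 - r)) * sqrt (real N ^ N / (4 * pi) ^ (N - 1)) * r powr - ((real N - 1) / 2)
        = sqrt (1 / (4 * pi * r * (1 - r)) * (real N ^ N / (4 * pi) ^ (N - 1)) * (1 / r ^ M))"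
      by (simp only: real_sqrt_mult real_sqrt_divide real_sqrt_one)
    also have "1 / (4 * pi * r * (1 - r)) * (real N ^ N / (4 * pi) ^ (N - 1)) * (1 / r ^ M)
        = real (Suc N) ^ Suc N / (4 * pi) ^ (Suc N - 1)"
    proof -
      define x where "x = real M + 1"
      have x: "x > 0" by (simp add: x_def)
      have "real N = x" "r = x / (x + 1)" "1 - r = 1 / (x + 1)" "real (Suc N) = x + 1"
        by (auto simp: N x_def r_def field_simps)
      then show ?thesis using x by (simp only: N) (simp add: power_divide divide_simps)
    qed
    finally show ?thesis .
  qed
  ultimately show ?case
    by (simp only: collision_prob_Suc[OF Suc.hyps(1)] r_def)
qed

section \<open>Cyclic shifts and boundaries\<close>

lemma bij_betw_cyclic_succ: "bij_betw (\<lambda>y. (y + 1) mod p) {0..<p} {0..<p::nat}"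
proof -
  have "inj_on (\<lambda>y. (y + 1) mod p) {0..<p}"
    by (auto simp: inj_on_def mod_Suc split: if_splits)
  moreover from this have "(\<lambda>y. (y + 1) mod p) ` {0..<p} = {0..<p}"
    by (intro endo_inj_surj) auto
  ultimately show ?thesis by (simp add: bij_betw_def)
qed

lemma image_mset_Diff_eq_iff:
  assumes "finite X" "finite Y"
  shows "image_mset b (mset_set X) = image_mset b (mset_set Y) \<longleftrightarrow>
    image_mset b (mset_set (X - Y)) = image_mset b (mset_set (Y - X))"
proof -
  have "mset_set X = mset_set (X - Y) + mset_set (X \<inter> Y)"
    by (subst mset_set_Union[symmetric]) (use assms in \<open>auto intro!: arg_cong[where f = mset_set]\<close>)
  moreover have "mset_set Y = mset_set (Y - X) + mset_set (X \<inter> Y)"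
    by (subst mset_set_Union[symmetric]) (use assms in \<open>auto intro!: arg_cong[where f = mset_set]\<close>)
  ultimately show ?thesis by simp
qed

lemma image_mset_indicator_pair:
  assumes "X \<subseteq> P" "finite P"
  shows "image_mset (\<lambda>y. (if y \<in> X then 1 else 0 :: nat, b y)) (mset_set P)
    = image_mset (Pair 1) (image_mset b (mset_set X)) + image_mset (Pair 0) (image_mset b (mset_set (P - X)))"
proof -
  have fin: "finite X" using assms finite_subset by blast
  have "mset_set P = mset_set X + mset_set (P - X)"
    by (subst mset_set_Union[symmetric]) (use assms fin in \<open>auto intro!: arg_cong[where f = mset_set]\<close>)
  then show ?thesis using assms fin by (auto simp: multiset.map_comp o_def intro!: arg_cong2[where f = "(+)"] image_mset_cong)
qed

lemma Pair_image_mset_add_eq_iff: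
  "image_mset (Pair (1::nat)) A + image_mset (Pair 0) B = image_mset (Pair 1) A' + image_mset (Pair 0) B'
    \<longleftrightarrow> A = A' \<and> B = B'"
proof
  assume eq: "image_mset (Pair (1::nat)) A + image_mset (Pair 0) B = image_mset (Pair 1) A' + image_mset (Pair 0) B'"
  have "image_mset snd (filter_mset (\<lambda>z. fst z = 1) (image_mset (Pair (1::nat)) A + image_mset (Pair 0) B)) = A"
    "image_mset snd (filter_mset (\<lambda>z. fst z = 0) (image_mset (Pair (1::nat)) A + image_mset (Pair 0) B)) = B" for A B :: "'a multiset"
    by (simp_all add: filter_mset_image_mset multiset.map_comp o_def)
  with eq show "A = A' \<and> B = B'" by metis
qed simp

text \<open>Sort the pairs by first coordinate. Those with 1 compare b on X with b on its shift Y,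
  and those with 0 compare the complements. The common part of X and Y then cancels.\<close>

lemma cyclic_condition_iff:
  assumes "X \<subseteq> {0..<p::nat}"
  defines "Y \<equiv> (\<lambda>y. (y + 1) mod p) ` X"
  shows "image_mset (\<lambda>y. (if y \<in> X then 1 else 0 :: nat, b y)) (mset_set {0..<p}) =
      image_mset (\<lambda>y. (if y \<in> X then 1 else 0 :: nat, b ((y + 1) mod p))) (mset_set {0..<p})
    \<longleftrightarrow> image_mset b (mset_set (X - Y)) = image_mset b (mset_set (Y - X))"
proof -
  let ?P = "{0..<p}" and ?s = "\<lambda>y. (y + 1) mod p"
  have inj: "inj_on ?s ?P" and im: "?s ` ?P = ?P" using bij_betw_cyclic_succ[of p] by (auto simp: bij_betw_def)
  have fin: "finite X" "finite Y" using assms finite_subset unfolding Y_def by blast+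
  have "Y \<subseteq> ?P" using assms im unfolding Y_def by blast
  have shift: "image_mset (\<lambda>y. b (?s y)) (mset_set S) = image_mset b (mset_set (?s ` S))" if "S \<subseteq> ?P" for S
    using arg_cong[OF image_mset_mset_set[OF inj_on_subset[OF inj that]], of "image_mset b"]
    by (simp add: multiset.map_comp o_def)
  have "?s ` (?P - X) = ?P - Y"
    using inj_on_image_set_diff[OF inj _ assms(1), of ?P] im unfolding Y_def by simp
  then have "image_mset (\<lambda>y. (if y \<in> X then 1 else 0 :: nat, b (?s y))) (mset_set ?P)
      = image_mset (Pair 1) (image_mset b (mset_set Y)) + image_mset (Pair 0) (image_mset b (mset_set (?P - Y)))"
    by (simp only: image_mset_indicator_pair[OF assms(1) finite_atLeastLessThan] shift[OF assms(1)] shift[OF Diff_subset] Y_def)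
  moreover have "image_mset (\<lambda>y. (if y \<in> X then 1 else 0 :: nat, b y)) (mset_set ?P)
    = image_mset (Pair 1) (image_mset b (mset_set X)) + image_mset (Pair 0) (image_mset b (mset_set (?P - X)))"
    using assms by (intro image_mset_indicator_pair) auto
  \<comment> \<open>The total content of b is fixed, so agreement on X and Y implies agreement on
    their complements.\<close>
  moreover have "image_mset b (mset_set ?P) = image_mset b (mset_set S) + image_mset b (mset_set (?P - S))"
    if "S \<subseteq> ?P" for S
  proof -
    have "mset_set ?P = mset_set S + mset_set (?P - S)"
      by (subst mset_set_Union[symmetric]) (use that finite_subset[OF that] in \<open>auto intro!: arg_cong[where f = mset_set]\<close>)
    then show ?thesis by simp
  qed
  from this[OF assms(1)] this[OF \<open>Y \<subseteq> ?P\<close>]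
  have "image_mset b (mset_set X) = image_mset b (mset_set Y) \<Longrightarrow>
      image_mset b (mset_set (?P - X)) = image_mset b (mset_set (?P - Y))"
    by simp
  ultimately show ?thesis
    using image_mset_Diff_eq_iff[OF fin, of b] by (auto simp only: Pair_image_mset_add_eq_iff)
qed

text \<open>For X inside {0..<p}, the points at which the indicator of X differs from its value at
  the cyclic predecessor.\<close>

definition boundary :: "nat \<Rightarrow> nat set \<Rightarrow> nat set" where
  "boundary p X = (let Y = (\<lambda>y. (y + 1) mod p) ` X in (X - Y) \<union> (Y - X))"

lemma card_Diff_cyclic_shift:
  assumes "X \<subseteq> {0..<p::nat}"
  shows "card (X - (\<lambda>y. (y + 1) mod p) ` X) = card ((\<lambda>y. (y + 1) mod p) ` X - X)"
proof -
  let ?Y = "(\<lambda>y. (y + 1) mod p) ` X"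
  have inj: "inj_on (\<lambda>y. (y + 1) mod p) X"
    using bij_betw_cyclic_succ[of p] assms by (auto simp: bij_betw_def intro: inj_on_subset)
  have "finite X" using assms finite_subset by blast
  then show ?thesis
    using card_image[OF inj] by (simp add: card_Diff_subset_Int Int_commute)
qed

lemma card_boundary:
  assumes "X \<subseteq> {0..<p::nat}"
  shows "card (boundary p X) = 2 * card (X - (\<lambda>y. (y + 1) mod p) ` X)"
proof -
  have "finite X" using assms finite_subset by blast
  then show ?thesis
    unfolding boundary_def Let_def by (subst card_Un_disjoint) (use card_Diff_cyclic_shift[OF assms] in auto)
qed

text \<open>The boundary splits into two disjoint halves of equal size, on which b must form two
  words of equal content; elsewhere b is free.\<close>

lemma card_labellings_of_set:
  assumes "X \<subseteq> {0..<p::nat}"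
  defines "Y \<equiv> (\<lambda>y. (y + 1) mod p) ` X"
  shows "card {b \<in> {0..<p} \<rightarrow>\<^sub>E {0..<N}. image_mset b (mset_set (X - Y)) = image_mset b (mset_set (Y - X))}
    = multinomial_sq N (card (boundary p X) div 2) * N ^ (p - card (boundary p X))"
proof -
  have fin: "finite X" "finite Y" using assms finite_subset unfolding Y_def by blast+
  define C where "C = (X - Y) \<union> (Y - X)"
  define D where "D = {0..<p} - C"
  have "Y \<subseteq> {0..<p}" using assms bij_betw_cyclic_succ[of p] unfolding Y_def bij_betw_def by blast
  then have C: "C \<subseteq> {0..<p}" using assms by (auto simp: C_def)
  then have P: "{0..<p} = C \<union> D" by (auto simp: D_def)
  have C_eq: "C = boundary p X" by (simp add: C_def boundary_def Y_def Let_def)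
  let ?Q = "\<lambda>b. image_mset b (mset_set (X - Y)) = image_mset b (mset_set (Y - X))"
  have "{b \<in> {0..<p} \<rightarrow>\<^sub>E {0..<N}. ?Q b} = {b \<in> C \<union> D \<rightarrow>\<^sub>E {0..<N}. ?Q (restrict b C)}"
    unfolding P by (simp add: image_mset_restrict_cong C_def)
  also have "card \<dots> = card {b \<in> C \<rightarrow>\<^sub>E {0..<N}. ?Q b} * N ^ card D"
    by (subst card_PiE_Un_restrict) (auto simp: D_def)
  also have "card {b \<in> C \<rightarrow>\<^sub>E {0..<N}. ?Q b} = multinomial_sq N (card (X - Y))"
    unfolding C_def using fin card_Diff_cyclic_shift[OF assms(1)]
    by (intro card_PiE_image_mset_eq) (auto simp: Y_def)
  also have "card D = p - card C" unfolding D_def using C by (subst card_Diff_subset) (auto intro: finite_subset)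
  finally show ?thesis using card_boundary[OF assms(1)] by (simp add: C_eq Y_def)
qed

text \<open>Whether p - 1 lies in X decides whether 0 lies in the shift, and the boundary then
  decides whether 0 lies in X. From there the boundary determines X point by point.\<close>

lemma boundary_inj:
  assumes p: "p > 0" and X: "X \<subseteq> {0..<p}" "X' \<subseteq> {0..<p}"
    and eq: "p - 1 \<in> X \<longleftrightarrow> p - 1 \<in> X'" "boundary p X = boundary p X'"
  shows "X = X'"
proof -
  have mem: "y \<in> boundary p Z \<longleftrightarrow> (y \<in> Z) \<noteq> (y \<in> (\<lambda>y. (y + 1) mod p) ` Z)" for y Z
    by (auto simp: boundary_def Let_def)
  have zero: "0 \<in> (\<lambda>y. (y + 1) mod p) ` Z \<longleftrightarrow> p - 1 \<in> Z" if "Z \<subseteq> {0..<p}" for Z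
    using that p by (force simp: mod_Suc image_iff split: if_splits)
  have succ: "Suc y \<in> (\<lambda>y. (y + 1) mod p) ` Z \<longleftrightarrow> y \<in> Z" if "Z \<subseteq> {0..<p}" "Suc y < p" for y Z
    using that p by (force simp: mod_Suc image_iff split: if_splits)
  have "y < p \<Longrightarrow> y \<in> X \<longleftrightarrow> y \<in> X'" for y
  proof (induction y)
    case 0
    show ?case using mem[of 0 X] mem[of 0 X'] zero[OF X(1)] zero[OF X(2)] eq by metis
  next
    case (Suc y)
    then show ?case
      using mem[of "Suc y" X] mem[of "Suc y" X'] succ[OF X(1)] succ[OF X(2)] eq(2) by auto
  qed
  then show ?thesis using X by auto
qed

text \<open>Surjectivity comes from counting: for p > 0 half of the subsets have even size, so both
  sides have 2^p elements.\<close>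

lemma bij_betw_boundary:
  assumes p: "p > 0"
  shows "bij_betw (\<lambda>X. (p - 1 \<in> X, boundary p X)) (Pow {0..<p}) (UNIV \<times> {S \<in> Pow {0..<p}. even (card S)})"
    (is "bij_betw ?\<Phi> _ ?T")
proof -
  have inj: "inj_on ?\<Phi> (Pow {0..<p})"
    using boundary_inj[OF p] by (auto simp: inj_on_def)
  have sub: "?\<Phi> ` Pow {0..<p} \<subseteq> ?T"
  proof (rule image_subsetI)
    fix X assume "X \<in> Pow {0..<p}"
    then have X: "X \<subseteq> {0..<p}" by simp
    then have "boundary p X \<subseteq> {0..<p}"
      using bij_betw_cyclic_succ[of p] unfolding bij_betw_def boundary_def Let_def by blast
    then show "?\<Phi> X \<in> ?T" using card_boundary[OF X] by simp
  qed
  have "card {S \<in> Pow {0..<p}. even (card S)} = (\<Sum>S\<in>Pow {0..<p}. if even (card S) then 1 else 0)"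
    by (subst sum.inter_filter[symmetric]) auto
  also have "\<dots> = (\<Sum>j\<le>p. (p choose j) * (if even j then 1 else 0))"
    using sum_Pow_card[of "{0..<p}" "\<lambda>j. if even j then 1 else 0"] by simp
  finally have "int (2 * card {S \<in> Pow {0..<p}. even (card S)}) = 2 * (\<Sum>j\<le>p. if even j then int (p choose j) else 0)"
    by (simp add: if_distrib cong: if_cong)
  also have "\<dots> = int (2 ^ p)" using choose_even_sum[OF p, where 'a = int] by simp
  finally have "card ?T = 2 ^ p"
    by (simp only: of_nat_eq_iff card_cartesian_product card_UNIV_bool)
  also have "\<dots> = card (?\<Phi> ` Pow {0..<p})" using card_image[OF inj] by (simp only: card_Pow finite_atLeastLessThan card_atLeastLessThan diff_zero)
  finally have "?\<Phi> ` Pow {0..<p} = ?T"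
    using sub by (intro card_subset_eq) auto
  with inj show ?thesis by (simp add: bij_betw_def)
qed

text \<open>Summing over the sets X coding a, the count depends only on the size j of the boundary.
  The factor 2 is the free bit telling whether p - 1 lies in X.\<close>

lemma card_cyc_pairs_2:
  assumes p: "p > 0"
  shows "card (cyc_pairs 2 N p)
    = 2 * (\<Sum>j\<le>p. (p choose j) * (if even j then multinomial_sq N (j div 2) * N ^ (p - j) else 0))"
proof -
  let ?P = "{0..<p}"
  let ?a = "\<lambda>X. \<lambda>y\<in>?P. if y \<in> X then 1 else 0 :: nat"
  let ?h = "\<lambda>j. multinomial_sq N (j div 2) * N ^ (p - j)"
  define F where "F a = {b \<in> ?P \<rightarrow>\<^sub>E {0..<N}. image_mset (\<lambda>y. (a y, b y)) (mset_set ?P) =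
     image_mset (\<lambda>y. (a y, b ((y + 1) mod p))) (mset_set ?P)}" for a :: "nat \<Rightarrow> nat"
  have "cyc_pairs 2 N p = Sigma (?P \<rightarrow>\<^sub>E {0..<2}) F"
  proof (rule set_eqI)
    fix z show "z \<in> cyc_pairs 2 N p \<longleftrightarrow> z \<in> Sigma (?P \<rightarrow>\<^sub>E {0..<2}) F"
      by (cases z) (simp add: cyc_pairs_def F_def)
  qed
  then have "card (cyc_pairs 2 N p) = (\<Sum>a\<in>?P \<rightarrow>\<^sub>E {0..<2}. card (F a))"
    by (simp add: card_SigmaI finite_PiE F_def)
  also have "\<dots> = (\<Sum>X\<in>Pow ?P. card (F (?a X)))"
  proof (rule sum.reindex_bij_witness[where i = ?a and j = "\<lambda>a. {y \<in> ?P. a y = 1}"])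
    fix a assume a: "a \<in> ?P \<rightarrow>\<^sub>E {0..<2::nat}"
    then have "a y = 0 \<or> a y = 1" if "y < p" for y using that by (force simp: PiE_iff)
    then show *: "?a {y \<in> ?P. a y = 1} = a"
      using a by (auto simp: fun_eq_iff PiE_def extensional_def restrict_def)
    show "card (F (?a {y \<in> ?P. a y = 1})) = card (F a)" unfolding * ..
  qed (auto split: if_splits)
  also have "\<dots> = (\<Sum>X\<in>Pow ?P. ?h (card (boundary p X)))"
  proof (intro sum.cong refl)
    fix X assume "X \<in> Pow ?P"
    then have X: "X \<subseteq> ?P" by simp
    have "F (?a X) = {b \<in> ?P \<rightarrow>\<^sub>E {0..<N}. image_mset (\<lambda>y. (if y \<in> X then 1 else 0 :: nat, b y)) (mset_set ?P) =
      image_mset (\<lambda>y. (if y \<in> X then 1 else 0 :: nat, b ((y + 1) mod p))) (mset_set ?P)}"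
    proof -
      have "image_mset (\<lambda>y. (?a X y, c y)) (mset_set ?P)
          = image_mset (\<lambda>y. (if y \<in> X then 1 else 0 :: nat, c y)) (mset_set ?P)" for c :: "nat \<Rightarrow> nat"
        by (rule image_mset_cong) simp
      then show ?thesis unfolding F_def by simp
    qed
    also have "card \<dots> = ?h (card (boundary p X))"
      unfolding cyclic_condition_iff[OF X] by (rule card_labellings_of_set[OF X])
    finally show "card (F (?a X)) = ?h (card (boundary p X))" .
  qed
  also have "\<dots> = (\<Sum>z\<in>(UNIV :: bool set) \<times> {S \<in> Pow ?P. even (card S)}. ?h (card (snd z :: nat set)))"
    using sum.reindex_bij_betw[OF bij_betw_boundary[OF p], of "\<lambda>z. ?h (card (snd z))"] by simp
  also have "\<dots> = (\<Sum>e\<in>(UNIV :: bool set). \<Sum>S\<in>{S \<in> Pow ?P. even (card S)}. ?h (card S))"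
    unfolding sum.cartesian_product by (intro sum.cong) auto
  also have "\<dots> = 2 * (\<Sum>S\<in>{S \<in> Pow ?P. even (card S)}. ?h (card S))"
    by (simp add: card_UNIV_bool)
  also have "(\<Sum>S\<in>{S \<in> Pow ?P. even (card S)}. ?h (card S)) = (\<Sum>S\<in>Pow ?P. if even (card S) then ?h (card S) else 0)"
    by (rule sum.inter_filter) simp
  also have "\<dots> = (\<Sum>j\<le>p. (p choose j) * (if even j then ?h j else 0))"
    using sum_Pow_card[of ?P "\<lambda>j. if even j then ?h j else 0"] by simp
  finally show ?thesis .
qed

section \<open>The asymptotics of delta\<close>

text \<open>The doubled even weights are the binomial(p, 1/2) law conditioned on being even. For
  even j, N^(p - j) / N^p = N^(-j) is the normalisation of the collision probability at j /
  2.\<close>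

lemma delta_2_eq:
  assumes "N \<ge> 1" "p > 0"
  shows "delta 2 N p = (\<Sum>j\<le>p. (if even j then 2 * binomial_weight p (1 / 2) j else 0) * collision_prob N (j div 2))"
proof -
  have "delta 2 N p = (\<Sum>j\<le>p. 2 * real ((p choose j) * (if even j then multinomial_sq N (j div 2) * N ^ (p - j) else 0)) / (2 * real N) ^ p)"
    unfolding delta_def card_cyc_pairs_2[OF assms(2)]
    by (simp add: sum_distrib_left sum_divide_distrib)
  also have "\<dots> = (\<Sum>j\<le>p. (if even j then 2 * binomial_weight p (1 / 2) j else 0) * collision_prob N (j div 2))"
  proof (intro sum.cong refl)
    fix j assume "j \<in> {..p}"
    then obtain l where p: "p = j + l" using le_Suc_ex by auto
    have "binomial_weight p (1 / 2) j = real (p choose j) / 2 ^ p"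
      by (simp add: binomial_weight_def p power_add power_divide)
    then show "2 * real ((p choose j) * (if even j then multinomial_sq N (j div 2) * N ^ (p - j) else 0)) / (2 * real N) ^ p
        = (if even j then 2 * binomial_weight p (1 / 2) j else 0) * collision_prob N (j div 2)"
      using assms(1) by (simp add: collision_prob_def p power_add power_mult_distrib mult_ac)
  qed
  finally show ?thesis .
qed

text \<open>Here j concentrates at p / 2, so the words have length about p / 4; the resulting 4^((N
  - 1)/2) cancels the 4 in (4 pi)^(N - 1) under the root.\<close>

lemma delta_2_tendsto:
  assumes N: "N \<ge> 1"
  shows "(\<lambda>p. delta 2 N p * real p powr ((real N - 1) / 2)) \<longlonglongrightarrow> sqrt (real N ^ N / pi ^ (N - 1))"
proof -
  let ?a = "(real N - 1) / 2"
  let ?mu = "\<lambda>p j. if even j then 2 * binomial_weight p (1 / 2) j else 0"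
  \<comment> \<open>The total mass is 1 except at p = 0, where 0^0 = 1 makes it 2.\<close>
  have "(\<Sum>j\<le>p. ?mu p j) = 1 + 0 ^ p" for p
  proof -
    have "(\<Sum>j\<le>p. ?mu p j) = 2 * (\<Sum>j\<le>p. if even j then binomial_weight p (1 / 2) j else 0)"
      unfolding sum_distrib_left by (intro sum.cong refl) simp
    then show ?thesis by (simp add: sum_even_binomial_weight)
  qed
  moreover have "(\<lambda>p. 1 + 0 ^ p :: real) \<longlonglongrightarrow> 1 + 0"
    by (intro tendsto_intros LIMSEQ_power_zero) simp
  ultimately have lim_mu: "(\<lambda>p. (\<Sum>j\<le>p. ?mu p j) * real p powr 0) \<longlonglongrightarrow> 1"
    unfolding tendsto_mult_powr_0 by simp
  have "(\<lambda>p. (\<Sum>j\<le>p. ?mu p j * collision_prob N (j div 2)) * real p powr (?a + 0)) \<longlonglongrightarrow>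
      1 * (sqrt (real N ^ N / (4 * pi) ^ (N - 1)) * 2 powr ?a) * (1 / 2) powr - ?a"
  proof (rule binomial_average_tendsto[OF _ _ _ _ _ _ tendsto_powr_halved[OF collision_prob_tendsto[OF N]] lim_mu])
    show "0 \<le> ?mu n j" "?mu n j \<le> 2 * (real (n choose j) * (1 / 2) ^ j * (1 - 1 / 2) ^ (n - j))" for n j
      using binomial_weight_nonneg[of "1 / 2" n j] by (auto simp: binomial_weight_def)
  qed (use N collision_prob_nonneg collision_prob_le_1 in auto)
  moreover have "1 * (sqrt (real N ^ N / (4 * pi) ^ (N - 1)) * 2 powr ?a) * (1 / 2) powr - ?a = sqrt (real N ^ N / pi ^ (N - 1))"
  proof -
    obtain M where M: "N = Suc M" using N by (cases N) auto
    have "2 powr ?a = (2 powr real M) powr (1 / 2)" "(1 / 2) powr - ?a = (2 powr real M) powr (1 / 2)"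
      by (simp_all add: M powr_powr powr_divide powr_minus_divide)
    then have "2 powr ?a = sqrt (2 ^ M)" "(1 / 2) powr - ?a = sqrt (2 ^ M)"
      by (simp_all add: powr_half_sqrt powr_realpow)
    then have "1 * (sqrt (real N ^ N / (4 * pi) ^ (N - 1)) * 2 powr ?a) * (1 / 2) powr - ?a
        = sqrt (real N ^ N / (4 * pi) ^ M * 2 ^ M * 2 ^ M)"
      by (simp only: real_sqrt_mult mult_1 M diff_Suc_1)
    also have "real N ^ N / (4 * pi) ^ M * 2 ^ M * 2 ^ M = real N ^ N / pi ^ M"
    proof -
      have "(4 :: real) ^ M = 2 ^ M * 2 ^ M" by (simp flip: power_mult_distrib)
      then show ?thesis by (simp add: power_mult_distrib)
    qed
    finally show ?thesis by (simp add: M)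
  qed
  ultimately have "(\<lambda>p. (\<Sum>j\<le>p. ?mu p j * collision_prob N (j div 2)) * real p powr ?a) \<longlonglongrightarrow> sqrt (real N ^ N / pi ^ (N - 1))"
    by simp
  then show ?thesis
    by (rule Lim_transform_eventually)
      (use eventually_gt_at_top[of 0] in \<open>eventually_elim, simp add: delta_2_eq[OF N]\<close>)
qed

theorem theorem6p4:
  fixes N :: nat
  assumes "N \<ge> 1"
  shows "(\<lambda>p. delta 2 N p) \<sim>[at_top] (\<lambda>p. sqrt (real N ^ N / (pi * real p) ^ (N - 1)))"
proof (rule asymp_equivI')
  define K where "K = sqrt (real N ^ N / pi ^ (N - 1))"
  have K: "K > 0" using assms by (simp add: K_def)
  have "(\<lambda>p. delta 2 N p * real p powr ((real N - 1) / 2) / K) \<longlonglongrightarrow> K / K"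
    using delta_2_tendsto[OF assms] K by (intro tendsto_divide) (auto simp: K_def)
  \<comment> \<open>For p > 0 the real power of p is the square root of p^(N - 1), so the comparison
    sequence is K divided by that power.\<close>
  moreover have "\<forall>\<^sub>F p in sequentially. delta 2 N p * real p powr ((real N - 1) / 2) / K
      = delta 2 N p / sqrt (real N ^ N / (pi * real p) ^ (N - 1))"
    using eventually_gt_at_top[of 0]
  proof eventually_elim
    case (elim p)
    have "real p powr ((real N - 1) / 2) = (real p powr real (N - 1)) powr (1 / 2)"
      using assms by (simp add: powr_powr)
    also have "\<dots> = sqrt (real p ^ (N - 1))"
      using elim by (simp add: powr_half_sqrt powr_realpow)
    finally have "sqrt (real N ^ N / (pi * real p) ^ (N - 1)) = K / real p powr ((real N - 1) / 2)"
      by (simp add: K_def power_mult_distrib real_sqrt_mult real_sqrt_divide)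
    then show ?case by simp
  qed
  ultimately show "(\<lambda>p. delta 2 N p / sqrt (real N ^ N / (pi * real p) ^ (N - 1))) \<longlonglongrightarrow> 1"
    using K by (simp add: Lim_transform_eventually)
qed

end
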